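(* Let $\epsilon>0$, let the step size be $\eta=\frac{1}{6L}$, let $b\in[1,n]$ denote the minibatch size, and let the epoch length be $m=\sqrt{b}$. Suppose the following Polyak-Łojasiewicz (PL) condition holds: there is $\mu>0$ such that $$\|\mathcal{G}_\eta(x)\|^2\ge 2\mu\,(\Phi(x)-\Phi^* )\quad\text{for all }x\text{ with }\Phi(x)<+\infty,$$ and assume $L/\mu>\sqrt{n}$. Then, for a suitable number $S$ of epochs, the final iteration point $\widetilde{x}^S$ of the ProxSVRG+ algorithm satisfies $\mathbb{E}[\Phi(\widetilde{x}^S)-\Phi^*]\le\epsilon$, with the following oracle complexity in the two cases below. 1) Let the batch size be $B=n$. The number of SFO calls is bounded by $$O\Big(\frac{n}{\mu\sqrt{b}}\log\frac1\epsilon+\frac{b}{\mu}\log\frac1\epsilon\Big).$$ 2) Assume that $\mathbb{E}[\|\nabla f_i(x)-\nabla f(x)\|^2]\le\sigma^2$ for all $x$, where $\sigma>0$ is a constant and the expectation is over $i$ uniform in $[n]$. Let the batch size be $B=\min\{\frac{6\sigma^2}{\mu\epsilon},\,n\}$. The number of SFO calls is bounded by $$O\Big(\big(n\wedge\tfrac{1}{\mu\epsilon}\big)\frac{1}{\mu\sqrt{b}}\log\frac1\epsilon+\frac{b}{\mu}\log\frac1\epsilon\Big),$$ where $\wedge$ denotes the minimum. In both cases, the number of PO calls equals the total number of iterations $T=Sm$, which is bounded by $$O\Big(\frac1\mu\log\frac1\epsilon\Big).$$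
   Context: Problem: minimize $\Phi(x):=f(x)+h(x)$ over $x\in\mathbb{R}^d$, where $f(x)=\frac1n\sum_{i=1}^n f_i(x)$. Each $f_i:\mathbb{R}^d\to\mathbb{R}$ is differentiable, possibly nonconvex, with $L$-Lipschitz gradient: $\|\nabla f_i(x)-\nabla f_i(y)\|\le L\|x-y\|$ for all $x,y$ (Euclidean norm, $L>0$). The function $h:\mathbb{R}^d\to\mathbb{R}\cup\{+\infty\}$ is convex, possibly nonsmooth (e.g. an $\ell_1$ norm or the indicator function of a convex set), proper, and such that its proximal operator $$\mathrm{prox}_{\eta h}(x):=\arg\min_{y\in\mathbb{R}^d}\Big(h(y)+\frac{1}{2\eta}\|y-x\|^2\Big)$$ is well defined. $\Phi^*$ denotes the (global) optimal value of $\Phi$. $[n]=\{1,\dots,n\}$. Gradient mapping: $\mathcal{G}_\eta(x):=\frac1\eta\big(x-\mathrm{prox}_{\eta h}(x-\eta\nabla f(x))\big)$. Algorithm ProxSVRG+ (inputs: initial point $x_0$, batch size $B$, minibatch size $b$, epoch length $m$, step size $\eta$, number of epochs $S$): set $\widetilde{x}^0=x_0$. For $s=1,\dots,S$: set $x_0^s=\widetilde{x}^{s-1}$ and $g^s=\frac1B\sum_{j\in I_B}\nabla f_j(\widetilde{x}^{s-1})$; for $t=1,\dots,m$ set $$v_{t-1}^s=\frac1b\sum_{i\in I_b}\big(\nabla f_i(x_{t-1}^s)-\nabla f_i(\widetilde{x}^{s-1})\big)+g^s,\qquad x_t^s=\mathrm{prox}_{\eta h}(x_{t-1}^s-\eta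 v_{t-1}^s);$$ then set $\widetilde{x}^s=x_m^s$. Under the PL condition the output is the final point $\widetilde{x}^S$. Here $I_b$ (drawn afresh at each inner iteration) consists of $b$ independent uniform indices from $[n]$; $I_B$ (drawn afresh at each epoch) consists of $B$ independent uniform indices from $[n]$ if $B<n$, and $g^s=\nabla f(\widetilde{x}^{s-1})$ if $B=n$; all samples are mutually independent. Oracles: a stochastic first-order oracle (SFO) call at $x$ returns a stochastic gradient $\nabla f_i(x)$ with $\mathbb{E}_{i\sim[n]}[\nabla f_i(x)]=\nabla f(x)$; a proximal oracle (PO) call at $x$ returns $\mathrm{prox}_{\eta h}(x)$. SFO calls are counted as $B$ per epoch plus $b$ per inner iteration, i.e. $SB+Smb$ in total; one PO call is made per inner iteration. The quantities $m=\sqrt b$, $B$, $S$ are treated as positive integers (rounding is ignored). The $O(\cdot)$ notation is for small $\epsilon$ (say $\epsilon\le 1/2$) and hides factors depending only on $L$, $\Phi(x_0)-\Phi^*$ and $\sigma$ (not on $n,b,\mu,\epsilon$). *)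

theory Defs
  imports "HOL-Probability.Probability"
begin

definition grad :: "('a::real_inner \<Rightarrow> real) \<Rightarrow> 'a \<Rightarrow> 'a" where
  "grad F x = (THE g. GDERIV F x :> g)"

definition favg :: "nat \<Rightarrow> (nat \<Rightarrow> 'a \<Rightarrow> real) \<Rightarrow> 'a \<Rightarrow> real" where
  "favg n f x = (\<Sum>i=1..n. f i x) / real n"

(* Functions to \<real> \<union> {+\<infinity>} are ereal-valued functions that avoid -\<infinity>.
   Excluding t = 0 and t = 1 keeps products of 0 and \<infinity> out of the inequality. *)
definition proper_fun :: "('a \<Rightarrow> ereal) \<Rightarrow> bool" where
  "proper_fun h \<longleftrightarrow> (\<forall>x. h x \<noteq> -\<infinity>) \<and> (\<exists>x. h x \<noteq> \<infinity>)"

definition convex_fun :: "('a::real_vector \<Rightarrow> ereal) \<Rightarrow> bool" where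
  "convex_fun h \<longleftrightarrow> (\<forall>x y t. 0 < t \<and> t < 1 \<longrightarrow>
     h ((1 - t) *\<^sub>R x + t *\<^sub>R y) \<le> ereal (1 - t) * h x + ereal t * h y)"

definition prox_obj :: "real \<Rightarrow> ('a::real_normed_vector \<Rightarrow> ereal) \<Rightarrow> 'a \<Rightarrow> 'a \<Rightarrow> ereal" where
  "prox_obj \<eta> h x y = h y + ereal (1 / (2 * \<eta>) * (norm (y - x))\<^sup>2)"

definition prox_well_defined :: "real \<Rightarrow> ('a::real_normed_vector \<Rightarrow> ereal) \<Rightarrow> bool" where
  "prox_well_defined \<eta> h \<longleftrightarrow> (\<forall>x. \<exists>!y. is_arg_min (prox_obj \<eta> h x) (\<lambda>_. True) y)"

definition prox :: "real \<Rightarrow> ('a::real_normed_vector \<Rightarrow> ereal) \<Rightarrow> 'a \<Rightarrow> 'a" where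
  "prox \<eta> h x = arg_min (prox_obj \<eta> h x) (\<lambda>_. True)"

definition Phi :: "nat \<Rightarrow> (nat \<Rightarrow> 'a \<Rightarrow> real) \<Rightarrow> ('a \<Rightarrow> ereal) \<Rightarrow> 'a \<Rightarrow> ereal" where
  "Phi n f h x = ereal (favg n f x) + h x"

definition Phi_opt :: "nat \<Rightarrow> (nat \<Rightarrow> 'a \<Rightarrow> real) \<Rightarrow> ('a \<Rightarrow> ereal) \<Rightarrow> ereal" where
  "Phi_opt n f h = (INF x. Phi n f h x)"

definition grad_mapping ::
  "nat \<Rightarrow> (nat \<Rightarrow> 'a::real_inner \<Rightarrow> real) \<Rightarrow> ('a \<Rightarrow> ereal) \<Rightarrow> real \<Rightarrow> 'a \<Rightarrow> 'a" where
  "grad_mapping n f h \<eta> x = (1 / \<eta>) *\<^sub>R (x - prox \<eta> h (x - \<eta> *\<^sub>R grad (favg n f) x))"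

(* If Phi_opt is -\<infinity> the left-hand side is \<infinity>, so the condition forces Phi_opt to be
   finite (for proper h). *)
definition PL_condition ::
  "nat \<Rightarrow> (nat \<Rightarrow> 'a::real_inner \<Rightarrow> real) \<Rightarrow> ('a \<Rightarrow> ereal) \<Rightarrow> real \<Rightarrow> real \<Rightarrow> bool" where
  "PL_condition n f h \<eta> \<mu> \<longleftrightarrow> (\<forall>x. Phi n f h x < \<infinity> \<longrightarrow>
     ereal (2 * \<mu>) * (Phi n f h x - Phi_opt n f h) \<le> ereal ((norm (grad_mapping n f h \<eta> x))\<^sup>2))"

definition variance_bound :: "nat \<Rightarrow> (nat \<Rightarrow> 'a::real_inner \<Rightarrow> real) \<Rightarrow> real \<Rightarrow> bool" where
  "variance_bound n f \<sigma> \<longleftrightarrow> (\<forall>x.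
     measure_pmf.expectation (pmf_of_set {1..n})
       (\<lambda>i. (norm (grad (f i) x - grad (favg n f) x))\<^sup>2) \<le> \<sigma>\<^sup>2)"

definition sample_mean :: "(nat \<Rightarrow> 'a::real_vector) \<Rightarrow> nat list \<Rightarrow> 'a" where
  "sample_mean G I = (1 / real (length I)) *\<^sub>R (\<Sum>i\<leftarrow>I. G i)"

definition sample_indices :: "nat \<Rightarrow> nat \<Rightarrow> nat list pmf" where
  "sample_indices n k = replicate_pmf k (pmf_of_set {1..n})"

(* Every algorithmic step is a pmf; sequencing with bind draws each sample afresh and
   independently of all earlier ones. *)
definition batch_grad ::
  "nat \<Rightarrow> (nat \<Rightarrow> 'a::real_inner \<Rightarrow> real) \<Rightarrow> nat \<Rightarrow> 'a \<Rightarrow> 'a pmf" where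
  "batch_grad n f B z =
     (if B = n then return_pmf (grad (favg n f) z)
      else map_pmf (sample_mean (\<lambda>j. grad (f j) z)) (sample_indices n B))"

primrec svrg_inner ::
  "nat \<Rightarrow> (nat \<Rightarrow> 'a::real_inner \<Rightarrow> real) \<Rightarrow> ('a \<Rightarrow> ereal) \<Rightarrow> real \<Rightarrow> nat \<Rightarrow> 'a \<Rightarrow> 'a \<Rightarrow> nat \<Rightarrow> 'a pmf"
where
  "svrg_inner n f h \<eta> b z g 0 = return_pmf z"
| "svrg_inner n f h \<eta> b z g (Suc t) =
     bind_pmf (svrg_inner n f h \<eta> b z g t) (\<lambda>x.
     bind_pmf (sample_indices n b) (\<lambda>I.
       let v = sample_mean (\<lambda>i. grad (f i) x - grad (f i) z) I + g
       in return_pmf (prox \<eta> h (x - \<eta> *\<^sub>R v))))"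

(* The distribution of the snapshot point after S epochs. *)
primrec prox_svrg_plus ::
  "nat \<Rightarrow> (nat \<Rightarrow> 'a::real_inner \<Rightarrow> real) \<Rightarrow> ('a \<Rightarrow> ereal) \<Rightarrow> 'a \<Rightarrow> nat \<Rightarrow> nat \<Rightarrow> nat \<Rightarrow> real \<Rightarrow> nat \<Rightarrow> 'a pmf"
where
  "prox_svrg_plus n f h x0 B b m \<eta> 0 = return_pmf x0"
| "prox_svrg_plus n f h x0 B b m \<eta> (Suc s) =
     bind_pmf (prox_svrg_plus n f h x0 B b m \<eta> s) (\<lambda>z.
     bind_pmf (batch_grad n f B z) (\<lambda>g. svrg_inner n f h \<eta> b z g m))"

(* Expectation of the nonnegative extended-real gap as a nonnegative integral: unlike the
   Bochner integral it does not turn infinite values into 0. *)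
definition expected_gap ::
  "nat \<Rightarrow> (nat \<Rightarrow> 'a \<Rightarrow> real) \<Rightarrow> ('a \<Rightarrow> ereal) \<Rightarrow> 'a pmf \<Rightarrow> ennreal" where
  "expected_gap n f h p = (\<integral>\<^sup>+ x. e2ennreal (Phi n f h x - Phi_opt n f h) \<partial>measure_pmf p)"

definition sfo_calls :: "nat \<Rightarrow> nat \<Rightarrow> nat \<Rightarrow> nat \<Rightarrow> nat" where
  "sfo_calls S m B b = (\<Sum>s=1..S. B + (\<Sum>t=1..m. b))"

definition po_calls :: "nat \<Rightarrow> nat \<Rightarrow> nat" where
  "po_calls S m = (\<Sum>s=1..S. \<Sum>t=1..m. 1)"

(* The factors hidden by O(.), with D the initial gap. The numerical values are generous
   and of no significance; what matters is which quantities occur. They are explicit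
   because the ambient space of the problem is a type: a constant quantified existentially
   inside a theorem could still depend on that type, hence on the dimension. *)
definition O_const :: "real \<Rightarrow> real \<Rightarrow> real" where
  "O_const L D = 100 * L * (1 + D)"

definition O_const_sigma :: "real \<Rightarrow> real \<Rightarrow> real \<Rightarrow> real" where
  "O_const_sigma L D \<sigma> = 100 * L * (1 + D) * (1 + L + 6 * \<sigma>\<^sup>2)"

end

theory Submission
  imports Defs
begin

text \<open>
  The idea is a linear contraction of the expected optimality gap, disturbed only by the error of the
  snapshot gradient.

  For a single step from \<open>x\<close> to \<open>y\<close> with direction \<open>v\<close>, two applications of the optimality condition of
  the proximal operator and one of the smoothness inequality give
  \<open>gap y \<le> \<rho> gap x - (5 L / 2) |y - x|\<^sup>2 + |v - grad F x|\<^sup>2 / (12 L)\<close> with \<open>\<rho> = 1 - \<mu> / (6 L)\<close>; the factor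
  \<open>\<rho>\<close> comes from the PL condition (\<open>prox_gradient_step_gap\<close>). If \<open>v\<close> is the variance reduced estimator with
  snapshot \<open>z\<close> and snapshot gradient \<open>g\<close>, its expected squared error is at most
  \<open>(L\<^sup>2 / b) |x - z|\<^sup>2 + |g - grad F z|\<^sup>2\<close> (\<open>minibatch_estimator_variance\<close>), because independent centered
  samples are orthogonal in mean square.

  The drift \<open>|x - z|\<^sup>2\<close> is controlled by a potential: to the gap one adds \<open>c |x - z|\<^sup>2\<close>, where the
  weight \<open>c\<close> decreases linearly to zero over the epoch. The negative term \<open>- (5 L / 2) |y - x|\<^sup>2\<close> pays
  for the growth of the drift, and the decrease of \<open>c\<close> pays for the variance. This works for epochs of
  length \<open>m\<close> with \<open>m\<^sup>2 \<le> b\<close> and \<open>m \<le> L / \<mu>\<close>, and here the assumption \<open>L / \<mu> > sqrt n\<close> enters. The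
  potential then contracts by \<open>\<rho>\<close> in every step (\<open>potential_expected_decrease\<close>), up to the error of \<open>g\<close>.
  It equals the gap at both ends of the epoch, so over all epochs
  \<open>E gap \<le> \<rho> ^ (S m) gap x0 + e / (2 \<mu>)\<close> if \<open>e\<close> bounds the expected squared error of the snapshot
  gradients (\<open>prox_svrg_plus_expected_gap\<close>).

  For \<open>B = n\<close> one has \<open>e = 0\<close>; otherwise \<open>e = \<sigma>\<^sup>2 / B \<le> \<mu> \<epsilon> / 6\<close>. The first term falls below \<open>\<epsilon> / 2\<close> after
  \<open>S m\<close> of order \<open>(L / \<mu>) ln (1 / \<epsilon>)\<close> steps (\<open>sufficient_epochs\<close>), and the oracle calls are counted from
  this and \<open>m \<ge> sqrt b / 2\<close>.

  All distributions involved have finite support, so integrability is never an issue.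
\<close>

section \<open>Gradients and smoothness\<close>

lemma GDERIV_unique:
  fixes F :: "'a::real_inner \<Rightarrow> real"
  assumes "GDERIV F x :> g" "GDERIV F x :> g'"
  shows "g = g'"
proof -
  have "(\<lambda>h. inner h g) = (\<lambda>h. inner h g')"
    using assms unfolding gderiv_def by (rule has_derivative_unique)
  then have "inner (g - g') g = inner (g - g') g'"
    by (rule fun_cong)
  then have "inner (g - g') (g - g') = 0"
    by (simp add: inner_diff_right)
  then show ?thesis by simp
qed

lemma grad_eqI: "GDERIV F x :> g \<Longrightarrow> grad F x = g"
  unfolding grad_def by (rule the_equality) (auto intro: GDERIV_unique)

lemma GDERIV_grad:
  fixes F :: "'a::euclidean_space \<Rightarrow> real"
  assumes "F differentiable (at x)"
  shows "GDERIV F x :> grad F x"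
proof -
  obtain F' where F': "(F has_derivative F') (at x)"
    using assms unfolding differentiable_def by blast
  then interpret bounded_linear F' by (rule has_derivative_bounded_linear)
  have "F' h = inner h (\<Sum>b\<in>Basis. F' b *\<^sub>R b)" for h
  proof -
    have "F' h = F' (\<Sum>b\<in>Basis. inner h b *\<^sub>R b)"
      by (simp add: euclidean_representation)
    then show ?thesis
      by (simp add: sum scale inner_sum_right mult.commute)
  qed
  then have "F' = (\<lambda>h. inner h (\<Sum>b\<in>Basis. F' b *\<^sub>R b))"
    by blast
  with F' have "GDERIV F x :> (\<Sum>b\<in>Basis. F' b *\<^sub>R b)"
    unfolding gderiv_def by simp
  then show ?thesis using grad_eqI by metis
qed

text \<open>
  The function \<open>\<phi>\<close> below is the restriction of \<open>F\<close> to the segment from \<open>x\<close> to \<open>y\<close> minus the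
  claimed quadratic bound; by the Lipschitz condition its derivative is nonpositive.
\<close>

lemma lipschitz_gradient_upper_bound:
  fixes F :: "'a::real_inner \<Rightarrow> real"
  assumes deriv: "\<And>x. GDERIV F x :> g x" and lip: "L-lipschitz_on UNIV g"
  shows "F y \<le> F x + inner (g x) (y - x) + L / 2 * (norm (y - x))\<^sup>2"
proof -
  define d where "d = y - x"
  define \<phi> where
    "\<phi> t = F (x + t *\<^sub>R d) - t * inner (g x) d - L / 2 * t\<^sup>2 * (norm d)\<^sup>2" for t :: real
  have "\<phi> 1 \<le> \<phi> 0"
  proof (rule DERIV_nonpos_imp_nonincreasing[where f = \<phi>])
    fix t :: real assume "0 \<le> t" "t \<le> 1"
    have F: "(F has_derivative (\<lambda>h. inner h (g (x + t *\<^sub>R d)))) (at (x + t *\<^sub>R d))"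
      using deriv unfolding gderiv_def .
    have "((\<lambda>t. F (x + t *\<^sub>R d)) has_derivative (\<lambda>s. inner (s *\<^sub>R d) (g (x + t *\<^sub>R d)))) (at t)"
      by (rule has_derivative_compose[where g = F and f = "\<lambda>t. x + t *\<^sub>R d", OF _ F])
        (auto intro!: derivative_eq_intros)
    moreover have "(\<lambda>s. inner (s *\<^sub>R d) (g (x + t *\<^sub>R d))) = (*) (inner d (g (x + t *\<^sub>R d)))"
      by (rule ext) simp
    ultimately have "((\<lambda>t. F (x + t *\<^sub>R d)) has_field_derivative inner d (g (x + t *\<^sub>R d))) (at t)"
      by (simp only: has_field_derivative_def)
    then have "(\<phi> has_field_derivative
        (inner d (g (x + t *\<^sub>R d)) - inner (g x) d - L * t * (norm d)\<^sup>2)) (at t)"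
      unfolding \<phi>_def by (auto intro!: derivative_eq_intros)
    moreover have "inner d (g (x + t *\<^sub>R d)) - inner (g x) d \<le> L * t * (norm d)\<^sup>2"
    proof -
      have "inner d (g (x + t *\<^sub>R d)) - inner (g x) d = inner d (g (x + t *\<^sub>R d) - g x)"
        by (simp add: inner_diff_right inner_commute)
      also have "\<dots> \<le> norm d * norm (g (x + t *\<^sub>R d) - g x)"
        by (rule norm_cauchy_schwarz)
      also have "\<dots> \<le> norm d * (L * (t * norm d))"
        using lipschitz_onD[OF lip, of "x + t *\<^sub>R d" x] \<open>0 \<le> t\<close>
        by (intro mult_left_mono) (auto simp: dist_norm)
      finally show ?thesis by (simp add: power2_eq_square algebra_simps)
    qed
    ultimately show "\<exists>l. (\<phi> has_field_derivative l) (at t) \<and> l \<le> 0"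
      by fastforce
  qed simp
  then show ?thesis by (simp add: \<phi>_def d_def)
qed

lemma GDERIV_favg:
  fixes f :: "nat \<Rightarrow> 'a::euclidean_space \<Rightarrow> real"
  assumes "\<And>i x. i \<in> {1..n} \<Longrightarrow> f i differentiable (at x)"
  shows "GDERIV (favg n f) x :> (1 / real n) *\<^sub>R (\<Sum>i=1..n. grad (f i) x)"
proof -
  have "(f i has_derivative (\<lambda>h. inner h (grad (f i) x))) (at x)" if "i \<in> {1..n}" for i
    using GDERIV_grad[OF assms[OF that]] unfolding gderiv_def .
  then have "((\<lambda>x. (1 / real n) * (\<Sum>i=1..n. f i x)) has_derivative
      (\<lambda>h. (1 / real n) * (\<Sum>i=1..n. inner h (grad (f i) x)))) (at x)"
    by (intro has_derivative_mult_right has_derivative_sum)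
  then show ?thesis
    unfolding gderiv_def favg_def[abs_def] by (simp add: inner_sum_right)
qed

lemmas grad_favg = GDERIV_favg[THEN grad_eqI]

lemma lipschitz_on_grad_favg:
  fixes f :: "nat \<Rightarrow> 'a::euclidean_space \<Rightarrow> real"
  assumes n: "n > 0"
    and diff: "\<And>i x. i \<in> {1..n} \<Longrightarrow> f i differentiable (at x)"
    and lip: "\<And>i. i \<in> {1..n} \<Longrightarrow> L-lipschitz_on UNIV (grad (f i))"
  shows "L-lipschitz_on UNIV (grad (favg n f))"
proof (rule lipschitz_onI)
  show "0 \<le> L" using lipschitz_on_nonneg[OF lip[of 1]] n by simp
  fix x y
  let ?S = "\<Sum>i=1..n. grad (f i) x - grad (f i) y"
  have "norm ?S \<le> (\<Sum>i=1..n. L * dist x y)"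
    using lipschitz_onD[OF lip] by (intro sum_norm_le) (simp flip: dist_norm)
  then have S: "norm ?S \<le> real n * (L * dist x y)"
    by simp
  have "grad (favg n f) w = (1 / real n) *\<^sub>R (\<Sum>i=1..n. grad (f i) w)" for w
    by (rule grad_favg) (rule diff)
  then have "grad (favg n f) x - grad (favg n f) y = (1 / real n) *\<^sub>R ?S"
    by (simp add: scaleR_diff_right sum_subtractf)
  then have "dist (grad (favg n f) x) (grad (favg n f) y) = norm ?S / real n"
    by (simp only: dist_norm) simp
  also have "\<dots> \<le> L * dist x y"
    using S n by (simp add: divide_le_eq mult.commute)
  finally show "dist (grad (favg n f) x) (grad (favg n f) y) \<le> L * dist x y" .
qed

section \<open>The proximal operator of a convex function\<close>

lemma prox_minimizes:
  assumes "prox_well_defined \<eta> h"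
  shows "prox_obj \<eta> h x (prox \<eta> h x) \<le> prox_obj \<eta> h x z"
proof -
  have "is_arg_min (prox_obj \<eta> h x) (\<lambda>_. True) (prox \<eta> h x)"
    unfolding prox_def arg_min_def
  proof (rule someI_ex[where P = "is_arg_min (prox_obj \<eta> h x) (\<lambda>_. True)"])
    show "\<exists>y. is_arg_min (prox_obj \<eta> h x) (\<lambda>_. True) y"
      using assms unfolding prox_well_defined_def by (rule allE) (rule ex1_implies_ex)
  qed
  then show ?thesis by (simp add: is_arg_min_def not_less)
qed

lemma prox_finite:
  assumes "prox_well_defined \<eta> h" "proper_fun h"
  shows "\<bar>h (prox \<eta> h x)\<bar> \<noteq> \<infinity>"
proof -
  obtain z where z: "h z \<noteq> \<infinity>"
    using assms(2) unfolding proper_fun_def by blast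
  have "h (prox \<eta> h x) \<noteq> \<infinity>"
  proof
    assume "h (prox \<eta> h x) = \<infinity>"
    then have "prox_obj \<eta> h x z = \<infinity>"
      using prox_minimizes[OF assms(1), of x z] by (simp add: prox_obj_def)
    with z show False by (simp add: prox_obj_def)
  qed
  moreover have "h (prox \<eta> h x) \<noteq> -\<infinity>"
    using assms(2) unfolding proper_fun_def by blast
  ultimately show ?thesis by (cases "h (prox \<eta> h x)") simp_all
qed

text \<open>
  This is the first-order optimality condition of the proximal problem, obtained without
  subdifferentials: the minimizer \<open>y\<close> is compared with \<open>(1 - t) y + t z\<close>, convexity bounds \<open>h\<close> there,
  and division by \<open>t\<close> followed by \<open>t \<rightarrow> 0\<close> removes the quadratic remainder.
\<close>

lemma prox_variational_inequality:
  fixes x :: "'a::real_inner"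
  assumes wd: "prox_well_defined \<eta> h" and proper: "proper_fun h" and conv: "convex_fun h"
    and fin: "h z \<noteq> \<infinity>"
  shows "real_of_ereal (h (prox \<eta> h x)) + (1 / \<eta>) * inner (x - prox \<eta> h x) (z - prox \<eta> h x)
    \<le> real_of_ereal (h z)"
proof -
  define y where "y = prox \<eta> h x"
  have y: "\<bar>h y\<bar> \<noteq> \<infinity>" unfolding y_def by (rule prox_finite[OF wd proper])
  obtain hy where hy: "h y = ereal hy" using y by auto
  obtain hz where hz: "h z = ereal hz"
    using fin proper unfolding proper_fun_def by (metis ereal_cases)
  define k where "k = 1 / (2 * \<eta>)"
  define I where "I = inner (x - y) (z - y)"
  have key: "hy + 2 * k * I \<le> hz + t * (k * (norm (z - y))\<^sup>2)"
    if t: "0 < t" "t < 1" for t :: real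
  proof -
    define w where "w = (1 - t) *\<^sub>R y + t *\<^sub>R z"
    have "prox_obj \<eta> h x y \<le> prox_obj \<eta> h x w"
      unfolding y_def by (rule prox_minimizes[OF wd])
    also have "\<dots> \<le> (ereal (1 - t) * h y + ereal t * h z)
        + ereal (1 / (2 * \<eta>) * (norm (w - x))\<^sup>2)"
      unfolding prox_obj_def using conv t
      unfolding convex_fun_def w_def by (intro add_right_mono) blast
    finally have "hy + 1 / (2 * \<eta>) * (norm (y - x))\<^sup>2
        \<le> (1 - t) * hy + t * hz + 1 / (2 * \<eta>) * (norm (w - x))\<^sup>2"
      unfolding prox_obj_def hy hz by simp
    moreover have "(norm (w - x))\<^sup>2
        = (norm (y - x))\<^sup>2 - 2 * t * inner (x - y) (z - y) + t\<^sup>2 * (norm (z - y))\<^sup>2"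
    proof -
      have w: "w - x = (y - x) + t *\<^sub>R (z - y)"
        by (simp add: w_def algebra_simps)
      have cross: "inner (x - y) (z - y) = - inner (y - x) (z - y)"
        by (simp flip: inner_minus_left)
      show ?thesis
        unfolding w cross power2_norm_eq_inner power2_eq_square[of t]
        by (simp add: inner_add_left inner_add_right inner_commute)
    qed
    ultimately have "hy + k * (norm (y - x))\<^sup>2 \<le> (1 - t) * hy + t * hz
        + k * ((norm (y - x))\<^sup>2 - 2 * t * I + t\<^sup>2 * (norm (z - y))\<^sup>2)"
      unfolding k_def I_def by simp
    also have "\<dots> = hy + k * (norm (y - x))\<^sup>2
        + t * (hz + t * (k * (norm (z - y))\<^sup>2)) - t * (hy + 2 * k * I)"
      by (simp add: algebra_simps power2_eq_square)
    finally have "t * (hy + 2 * k * I) \<le> t * (hz + t * (k * (norm (z - y))\<^sup>2))"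
      by linarith
    then show ?thesis using t by simp
  qed
  have "((\<lambda>t. hz + t * (k * (norm (z - y))\<^sup>2)) \<longlongrightarrow> hz + 0 * (k * (norm (z - y))\<^sup>2)) (at_right 0)"
    by (intro tendsto_intros)
  moreover have "\<forall>\<^sub>F t in at_right 0. hy + 2 * k * I \<le> hz + t * (k * (norm (z - y))\<^sup>2)"
    using eventually_at_right_real[OF zero_less_one] by eventually_elim (use key in auto)
  ultimately have "hy + 2 * k * I \<le> hz + 0 * (k * (norm (z - y))\<^sup>2)"
    by (intro tendsto_lowerbound) auto
  then show ?thesis
    unfolding y_def[symmetric] hy hz k_def I_def by simp
qed

section \<open>Second moments of sample means\<close>

lemma expectation_bind_pmf_finite:
  fixes \<phi> :: "'b \<Rightarrow> real"
  assumes "finite (set_pmf p)" "\<And>x. x \<in> set_pmf p \<Longrightarrow> finite (set_pmf (q x))"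
  shows "measure_pmf.expectation (bind_pmf p q) \<phi>
    = measure_pmf.expectation p (\<lambda>x. measure_pmf.expectation (q x) \<phi>)"
  using assms by (subst pmf_expectation_bind[where A = "set_pmf p"])
    (auto simp: integral_measure_pmf[of "set_pmf p"])

lemma expectation_mono_finite:
  fixes \<phi> \<psi> :: "'b \<Rightarrow> real"
  assumes "finite (set_pmf p)" "\<And>x. x \<in> set_pmf p \<Longrightarrow> \<phi> x \<le> \<psi> x"
  shows "measure_pmf.expectation p \<phi> \<le> measure_pmf.expectation p \<psi>"
  using assms by (intro integral_mono_AE) (auto simp: integrable_measure_pmf_finite AE_measure_pmf_iff)

lemma finite_set_replicate_pmf:
  "finite (set_pmf p) \<Longrightarrow> finite (set_pmf (replicate_pmf k p))"
  by (induction k) auto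

text \<open>
  Squared norms of independent centered vectors add up, since the cross terms vanish. The shift \<open>a\<close> is
  what makes the induction on the number of samples work: the first sample is absorbed into it. It
  also gives the bias-variance decomposition used for the gradient estimator, whose bias is \<open>a\<close>.
\<close>

lemma expectation_norm2_centered_sum:
  fixes G :: "'b \<Rightarrow> 'a::euclidean_space"
  assumes fin: "finite (set_pmf p)" and centered: "measure_pmf.expectation p G = 0"
  shows "measure_pmf.expectation (replicate_pmf k p) (\<lambda>I. (norm (a + (\<Sum>i\<leftarrow>I. G i)))\<^sup>2)
    = (norm a)\<^sup>2 + real k * measure_pmf.expectation p (\<lambda>i. (norm (G i))\<^sup>2)"
proof (induction k arbitrary: a)
  case (Suc k)
  define V where "V = measure_pmf.expectation p (\<lambda>i. (norm (G i))\<^sup>2)"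
  note int = integrable_measure_pmf_finite[OF fin]
  have IH: "measure_pmf.expectation (replicate_pmf k p) (\<lambda>I. (norm (a + (\<Sum>i\<leftarrow>I. G i)))\<^sup>2)
      = (norm a)\<^sup>2 + real k * V" for a
    unfolding V_def by (rule Suc.IH)
  have expand: "(norm (a + G i))\<^sup>2 = (norm a)\<^sup>2 + 2 * inner a (G i) + (norm (G i))\<^sup>2" for i
    unfolding power2_norm_eq_inner by (simp add: inner_add_left inner_add_right inner_commute)
  have "measure_pmf.expectation (replicate_pmf (Suc k) p) (\<lambda>I. (norm (a + (\<Sum>i\<leftarrow>I. G i)))\<^sup>2)
    = measure_pmf.expectation p (\<lambda>i. measure_pmf.expectation (replicate_pmf k p)
        (\<lambda>I. (norm ((a + G i) + (\<Sum>i\<leftarrow>I. G i)))\<^sup>2))"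
    using fin finite_set_replicate_pmf[OF fin, of k]
    by (simp add: expectation_bind_pmf_finite add.assoc)
  also have "\<dots> = measure_pmf.expectation p
      (\<lambda>i. (norm a)\<^sup>2 + 2 * inner a (G i) + (norm (G i))\<^sup>2 + real k * V)"
    unfolding IH expand ..
  also have "\<dots> = (norm a)\<^sup>2 + 2 * inner a (measure_pmf.expectation p G) + V + real k * V"
    unfolding V_def by (simp add: int)
  finally show ?case
    unfolding centered V_def[symmetric] by (simp add: distrib_right)
qed simp

lemma finite_set_sample_indices: "n > 0 \<Longrightarrow> finite (set_pmf (sample_indices n k))"
  unfolding sample_indices_def by (rule finite_set_replicate_pmf) simp

text \<open>
  Centering at the mean \<open>c\<close> can only decrease the second moment, by the amount \<open>(norm c)\<^sup>2\<close>.
\<close>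

lemma expectation_uniform_norm2_centered_le:
  fixes G :: "nat \<Rightarrow> 'a::euclidean_space"
  assumes n: "n > 0" and mean: "c = (1 / real n) *\<^sub>R (\<Sum>i=1..n. G i)"
    and bound: "\<And>i. i \<in> {1..n} \<Longrightarrow> norm (G i) \<le> K"
  shows "measure_pmf.expectation (pmf_of_set {1..n}) (\<lambda>i. (norm (G i - c))\<^sup>2) \<le> K\<^sup>2"
proof -
  have sumG: "(\<Sum>i=1..n. G i) = real n *\<^sub>R c" using n mean by simp
  have "(\<Sum>i=1..n. (norm (G i - c))\<^sup>2)
      = (\<Sum>i=1..n. (norm (G i))\<^sup>2) - 2 * inner (\<Sum>i=1..n. G i) c + real n * (norm c)\<^sup>2"
    by (simp add: power2_norm_eq_inner inner_diff_left inner_diff_right inner_commute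
        inner_sum_right sum.distrib sum_subtractf sum_distrib_left algebra_simps)
  also have "\<dots> = (\<Sum>i=1..n. (norm (G i))\<^sup>2) - real n * (norm c)\<^sup>2"
    unfolding sumG by (simp add: power2_norm_eq_inner)
  also have "\<dots> \<le> (\<Sum>i=1..n. (norm (G i))\<^sup>2)"
    by simp
  also have "\<dots> \<le> (\<Sum>i=1..n. K\<^sup>2)"
    by (intro sum_mono power_mono bound) auto
  finally show ?thesis
    using n by (simp add: integral_pmf_of_set field_simps)
qed

lemma expectation_sample_mean_norm2:
  fixes G :: "nat \<Rightarrow> 'a::euclidean_space"
  assumes n: "n > 0" and k: "k > 0" and mean: "c = (1 / real n) *\<^sub>R (\<Sum>i=1..n. G i)"
  shows "measure_pmf.expectation (sample_indices n k) (\<lambda>I. (norm (a + (sample_mean G I - c)))\<^sup>2)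
    = (norm a)\<^sup>2 + measure_pmf.expectation (pmf_of_set {1..n}) (\<lambda>i. (norm (G i - c))\<^sup>2) / real k"
    (is "?lhs = _ + ?V / _")
proof -
  let ?p = "pmf_of_set {1..n}"
  define Q where "Q I = (norm (real k *\<^sub>R a + (\<Sum>i\<leftarrow>I. G i - c)))\<^sup>2" for I
  have fin: "finite (set_pmf ?p)" using n by simp
  have "measure_pmf.expectation ?p G = c"
    unfolding mean using n
    by (subst integral_measure_pmf[of "{1..n}"]) (auto simp: scaleR_sum_right)
  then have centered: "measure_pmf.expectation ?p (\<lambda>i. G i - c) = 0"
    by (subst Bochner_Integration.integral_diff)
      (auto intro: integrable_measure_pmf_finite fin[simplified])
  have Q: "measure_pmf.expectation (sample_indices n k) Q = (norm (real k *\<^sub>R a))\<^sup>2 + real k * ?V"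
    unfolding sample_indices_def Q_def by (rule expectation_norm2_centered_sum[OF fin centered])
  have sum_centered: "(\<Sum>i\<leftarrow>I. G i - c) = (\<Sum>i\<leftarrow>I. G i) - real (length I) *\<^sub>R c" for I
    by (induction I) (auto simp: algebra_simps)
  have rescale: "(norm (a + (sample_mean G I - c)))\<^sup>2 = (1 / (real k)\<^sup>2) * Q I"
    if "I \<in> set_pmf (sample_indices n k)" for I
  proof -
    have len: "length I = k"
      using that unfolding sample_indices_def set_replicate_pmf by simp
    have "a + (sample_mean G I - c) = (1 / real k) *\<^sub>R (real k *\<^sub>R a + (\<Sum>i\<leftarrow>I. G i - c))"
      using k unfolding sum_centered len sample_mean_def
      by (simp add: scaleR_add_right scaleR_diff_right)
    then have "(norm (a + (sample_mean G I - c)))\<^sup>2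
        = (norm ((1 / real k) *\<^sub>R (real k *\<^sub>R a + (\<Sum>i\<leftarrow>I. G i - c))))\<^sup>2"
      by (rule arg_cong)
    then show ?thesis
      unfolding norm_scaleR power_mult_distrib Q_def by (simp add: power_divide)
  qed
  have "?lhs = measure_pmf.expectation (sample_indices n k) (\<lambda>I. (1 / (real k)\<^sup>2) * Q I)"
    by (intro integral_cong_AE) (auto simp: AE_measure_pmf_iff rescale)
  also have "\<dots> = (1 / (real k)\<^sup>2) * ((real k)\<^sup>2 * (norm a)\<^sup>2 + real k * ?V)"
    unfolding integral_mult_right_zero Q by (simp add: power_mult_distrib)
  also have "\<dots> = (norm a)\<^sup>2 + ?V / real k"
    unfolding distrib_left using k by (simp add: power2_eq_square)
  finally show ?thesis .
qed

section \<open>Weighted inequalities for inner products\<close>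

text \<open>
  Young's inequality, from expanding the square of \<open>u - 2 c w\<close>.
\<close>

lemma inner_le_weighted_squares:
  fixes u w :: "'a::real_inner"
  assumes "c > 0"
  shows "inner u w \<le> c * (norm w)\<^sup>2 + (norm u)\<^sup>2 / (4 * c)"
proof -
  have "0 \<le> (norm (u - (2 * c) *\<^sub>R w))\<^sup>2 / (4 * c)"
    using assms by simp
  also have "(norm (u - (2 * c) *\<^sub>R w))\<^sup>2
      = (norm u)\<^sup>2 - 4 * c * inner u w + (4 * c) * (c * (norm w)\<^sup>2)"
    unfolding power2_norm_eq_inner
    by (simp add: inner_diff_left inner_diff_right inner_commute[of w u] right_diff_distrib)
  finally show ?thesis using assms by (simp add: add_divide_distrib diff_divide_distrib)
qed

lemma norm_add_square_le_weighted:
  fixes u w :: "'a::real_inner"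
  assumes "\<alpha> > 0"
  shows "(norm (u + w))\<^sup>2 \<le> (1 + \<alpha>) * (norm u)\<^sup>2 + (1 + 1 / \<alpha>) * (norm w)\<^sup>2"
proof -
  have "2 * inner u w \<le> \<alpha> * (norm u)\<^sup>2 + (1 / \<alpha>) * (norm w)\<^sup>2"
    using inner_le_weighted_squares[of "1 / (2 * \<alpha>)" u w] assms by (simp add: mult.commute)
  moreover have "(norm (u + w))\<^sup>2 = (norm u)\<^sup>2 + 2 * inner u w + (norm w)\<^sup>2"
    unfolding power2_norm_eq_inner by (simp add: inner_add_left inner_add_right inner_commute)
  ultimately show ?thesis by (simp add: distrib_right)
qed

section \<open>One proximal step under the Polyak-Lojasiewicz condition\<close>

text \<open>
  The condition \<open>\<mu> \<le> L\<close> makes the contraction factor \<open>\<rho>\<close> nonnegative. That an epoch has at most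
  \<open>L / \<mu>\<close> steps is a premise of the lemmas about the inner loop.
\<close>

locale prox_PL_problem =
  fixes f :: "nat \<Rightarrow> 'a::euclidean_space \<Rightarrow> real"
    and h :: "'a \<Rightarrow> ereal"
    and n :: nat
    and L \<mu> \<eta> :: real
  assumes n_pos: "n > 0"
    and L_pos: "L > 0"
    and diff: "\<And>i x. i \<in> {1..n} \<Longrightarrow> f i differentiable (at x)"
    and lip: "\<And>i. i \<in> {1..n} \<Longrightarrow> L-lipschitz_on UNIV (grad (f i))"
    and proper: "proper_fun h"
    and convex: "convex_fun h"
    and wd: "prox_well_defined \<eta> h"
    and eta: "\<eta> = 1 / (6 * L)"
    and mu_pos: "\<mu> > 0"
    and mu_le: "\<mu> \<le> L"
    and PL: "PL_condition n f h \<eta> \<mu>"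
begin

abbreviation "F \<equiv> favg n f"

text \<open>
  The optimality gap as a real number. It is meaningful only where \<open>h\<close> is finite; the
  lemmas on feasibility below show that the algorithm never leaves that set.
\<close>

definition gap :: "'a \<Rightarrow> real" where
  "gap x = F x + real_of_ereal (h x) - real_of_ereal (Phi_opt n f h)"

definition \<rho> :: real where "\<rho> = 1 - \<mu> / (6 * L)"

lemma rho_bounds: "0 \<le> \<rho>" "\<rho> < 1"
  using mu_pos mu_le L_pos by (auto simp: \<rho>_def field_simps)

lemma Phi_eq_ereal:
  "h x \<noteq> \<infinity> \<Longrightarrow> Phi n f h x = ereal (F x + real_of_ereal (h x))"
  using proper unfolding Phi_def proper_fun_def by (cases "h x") auto

lemma Phi_opt_le: "Phi_opt n f h \<le> Phi n f h x"
  unfolding Phi_opt_def by (rule INF_lower) simp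

text \<open>
  The PL inequality itself excludes an objective unbounded below: at a feasible point its left-hand
  side would be infinite.
\<close>

lemma Phi_opt_finite: "\<bar>Phi_opt n f h\<bar> \<noteq> \<infinity>"
proof -
  obtain z where "h z \<noteq> \<infinity>"
    using proper unfolding proper_fun_def by blast
  then obtain r where r: "Phi n f h z = ereal r"
    using Phi_eq_ereal by blast
  have "Phi_opt n f h \<noteq> - \<infinity>"
  proof
    assume "Phi_opt n f h = - \<infinity>"
    then show False
      using PL[unfolded PL_condition_def, rule_format, of z] mu_pos by (simp add: r)
  qed
  then show ?thesis
    using Phi_opt_le[of z] r by (cases "Phi_opt n f h") simp_all
qed

lemma Phi_minus_opt:
  assumes "h x \<noteq> \<infinity>"
  shows "Phi n f h x - Phi_opt n f h = ereal (gap x)"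
proof -
  obtain r where "Phi_opt n f h = ereal r"
    using Phi_opt_finite by (cases "Phi_opt n f h") simp_all
  then show ?thesis by (simp add: Phi_eq_ereal[OF assms] gap_def)
qed

lemma gap_nonneg:
  assumes "h x \<noteq> \<infinity>"
  shows "0 \<le> gap x"
proof -
  have "0 \<le> Phi n f h x - Phi_opt n f h"
    using Phi_opt_le[of x] Phi_opt_finite by (simp add: ereal_diff_positive)
  then show ?thesis by (simp add: Phi_minus_opt[OF assms])
qed

lemma PL_gap:
  assumes "h x \<noteq> \<infinity>"
  shows "2 * \<mu> * gap x \<le> (norm (grad_mapping n f h \<eta> x))\<^sup>2"
proof -
  have "ereal (2 * \<mu>) * (Phi n f h x - Phi_opt n f h) \<le> ereal ((norm (grad_mapping n f h \<eta> x))\<^sup>2)"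
  proof (rule PL[unfolded PL_condition_def, rule_format])
    show "Phi n f h x < \<infinity>" by (simp add: Phi_eq_ereal[OF assms])
  qed
  then show ?thesis by (simp add: Phi_minus_opt[OF assms])
qed

lemma h_prox_finite: "h (prox \<eta> h x) \<noteq> \<infinity>"
  using prox_finite[OF wd proper, of x] by auto

lemma smooth_upper: "F y \<le> F x + inner (grad F x) (y - x) + L / 2 * (norm (y - x))\<^sup>2"
proof (rule lipschitz_gradient_upper_bound)
  show "GDERIV F x :> grad F x" for x
  proof -
    have "GDERIV F x :> (1 / real n) *\<^sub>R (\<Sum>i=1..n. grad (f i) x)"
      by (rule GDERIV_favg) (rule diff)
    then show ?thesis using grad_eqI by metis
  qed
  show "L-lipschitz_on UNIV (grad F)"
    by (rule lipschitz_on_grad_favg[OF n_pos diff lip])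
qed

text \<open>
  One step with an arbitrary direction \<open>v\<close>. Let \<open>z\<close> be the point that the exact gradient would have
  produced. The optimality condition of \<open>y\<close> is tested at \<open>z\<close>, that of \<open>z\<close> at \<open>x\<close>, and the smooth part
  is bounded at \<open>y\<close>. In the sum all linear terms combine to \<open>inner (v - grad F x) (z - y)\<close>, which
  Young's inequality charges to the available \<open>3 L (norm (z - y))\<^sup>2\<close> and the error of \<open>v\<close>. What remains is a
  negative multiple of \<open>(norm (x - z))\<^sup>2\<close>, that is, of the squared gradient mapping, which the PL
  condition turns into the contraction, and the term \<open>- 5 L / 2 (norm (y - x))\<^sup>2\<close>, which pays for the
  variance of later steps.
\<close>

lemma prox_gradient_step_gap:
  assumes x: "h x \<noteq> \<infinity>" and y: "y = prox \<eta> h (x - \<eta> *\<^sub>R v)"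
  shows "gap y \<le> \<rho> * gap x - 5 * L / 2 * (norm (y - x))\<^sup>2 + (norm (v - grad F x))\<^sup>2 / (12 * L)"
proof -
  define g where "g = grad F x"
  define z where "z = prox \<eta> h (x - \<eta> *\<^sub>R g)"
  have z_fin: "h z \<noteq> \<infinity>" unfolding z_def by (rule h_prox_finite)
  define X Y Z where "X = (norm (x - y))\<^sup>2" and "Y = (norm (z - y))\<^sup>2" and "Z = (norm (x - z))\<^sup>2"
  have inv_eta: "1 / \<eta> = 6 * L" "6 * L * \<eta> = 1" using eta L_pos by auto
  have three_point: "inner (x - y) (z - y) = (X + Y - Z) / 2"
    unfolding X_def Y_def Z_def power2_norm_eq_inner
    by (simp add: inner_diff_left inner_diff_right inner_commute)
  have shift: "6 * L * inner (x - \<eta> *\<^sub>R u - a) b = 6 * L * inner (x - a) b - inner u b" for u a b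
  proof -
    have "6 * L * inner (x - \<eta> *\<^sub>R u - a) b = 6 * L * inner (x - a) b - (6 * L * \<eta>) * inner u b"
      by (simp add: inner_diff_left algebra_simps)
    then show ?thesis by (simp only: inv_eta mult_1_left)
  qed
  have "real_of_ereal (h y) + 6 * L * inner (x - \<eta> *\<^sub>R v - y) (z - y) \<le> real_of_ereal (h z)"
    using prox_variational_inequality[OF wd proper convex z_fin, of "x - \<eta> *\<^sub>R v"]
    unfolding y[symmetric] inv_eta .
  then have step_y: "real_of_ereal (h y) + 3 * L * (X + Y - Z) - inner v (z - y) \<le> real_of_ereal (h z)"
    unfolding shift three_point by simp
  have "real_of_ereal (h z) + 6 * L * inner (x - \<eta> *\<^sub>R g - z) (x - z) \<le> real_of_ereal (h x)"
    using prox_variational_inequality[OF wd proper convex x, of "x - \<eta> *\<^sub>R g"]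
    unfolding z_def[symmetric] inv_eta .
  then have step_z: "real_of_ereal (h z) + 6 * L * Z - inner g (x - z) \<le> real_of_ereal (h x)"
    unfolding shift Z_def power2_norm_eq_inner by linarith
  have smooth: "F y \<le> F x + inner g (y - x) + L / 2 * X"
    using smooth_upper[of y x] unfolding g_def X_def by (simp add: norm_minus_commute)
  have young: "inner (v - g) (z - y) \<le> 3 * L * Y + (norm (v - g))\<^sup>2 / (12 * L)"
    using inner_le_weighted_squares[of "3 * L" "v - g" "z - y"] L_pos by (simp add: Y_def)
  have "inner v (z - y) + inner g (x - z) + inner g (y - x) = inner (v - g) (z - y)"
    by (simp add: inner_diff_left inner_diff_right)
  then have "F y + real_of_ereal (h y)
      \<le> F x + real_of_ereal (h x) - 5 * L / 2 * X - 3 * L * Z + (norm (v - g))\<^sup>2 / (12 * L)"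
    using step_y step_z smooth young by (simp add: algebra_simps)
  moreover have "\<mu> / (6 * L) * gap x \<le> 3 * L * Z"
  proof -
    have "grad_mapping n f h \<eta> x = (6 * L) *\<^sub>R (x - z)"
      unfolding grad_mapping_def z_def g_def inv_eta ..
    then have "2 * \<mu> * gap x \<le> 36 * L\<^sup>2 * Z"
      using PL_gap[OF x] unfolding Z_def by (simp add: power_mult_distrib)
    then show ?thesis using L_pos by (simp add: field_simps power2_eq_square)
  qed
  ultimately show ?thesis
    unfolding gap_def \<rho>_def g_def X_def
    by (simp add: norm_minus_commute[of x y] algebra_simps)
qed

section \<open>Expected decrease within an epoch\<close>

text \<open>
  The bias of the estimator is the error of the snapshot gradient \<open>g\<close>; its random part is an average
  of \<open>b\<close> samples each of which has norm at most \<open>L * norm (x - z)\<close> before centering.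
\<close>

lemma minibatch_estimator_variance:
  assumes b: "b > 0"
  shows "measure_pmf.expectation (sample_indices n b)
      (\<lambda>I. (norm (sample_mean (\<lambda>i. grad (f i) x - grad (f i) z) I + g - grad F x))\<^sup>2)
    \<le> L\<^sup>2 / real b * (norm (x - z))\<^sup>2 + (norm (g - grad F z))\<^sup>2"
proof -
  define G where "G i = grad (f i) x - grad (f i) z" for i
  define c where "c = grad F x - grad F z"
  have "grad F w = (1 / real n) *\<^sub>R (\<Sum>i=1..n. grad (f i) w)" for w
    by (rule grad_favg) (rule diff)
  then have c: "c = (1 / real n) *\<^sub>R (\<Sum>i=1..n. G i)"
    unfolding c_def G_def by (simp add: sum_subtractf scaleR_diff_right)
  have bound: "norm (G i) \<le> L * norm (x - z)" if "i \<in> {1..n}" for i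
    using lipschitz_onD[OF lip[OF that], of x z] unfolding G_def by (simp add: dist_norm)
  have "sample_mean G I + g - grad F x = (g - grad F z) + (sample_mean G I - c)" for I
    unfolding c_def by simp
  then have "measure_pmf.expectation (sample_indices n b)
      (\<lambda>I. (norm (sample_mean G I + g - grad F x))\<^sup>2)
    = (norm (g - grad F z))\<^sup>2
      + measure_pmf.expectation (pmf_of_set {1..n}) (\<lambda>i. (norm (G i - c))\<^sup>2) / real b"
    by (simp only: expectation_sample_mean_norm2[OF n_pos b c])
  also have "\<dots> \<le> (norm (g - grad F z))\<^sup>2 + (L * norm (x - z))\<^sup>2 / real b"
    by (intro add_left_mono divide_right_mono expectation_uniform_norm2_centered_le[OF n_pos c bound]) auto
  finally show ?thesis unfolding G_def by (simp add: power_mult_distrib)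
qed

lemma finite_svrg_inner: "finite (set_pmf (svrg_inner n f h \<eta> b z g t))"
  using finite_set_sample_indices[OF n_pos] by (induction t) (auto simp: Let_def)

lemma svrg_inner_feasible:
  "h z \<noteq> \<infinity> \<Longrightarrow> x \<in> set_pmf (svrg_inner n f h \<eta> b z g t) \<Longrightarrow> h x \<noteq> \<infinity>"
  by (cases t) (auto simp: Let_def h_prox_finite)

text \<open>
  The weight of \<open>(norm (x - z))\<^sup>2\<close> in the potential after \<open>t\<close> of \<open>m\<close> inner steps. It decreases linearly so
  that each step releases enough to cover the minibatch variance, which is proportional to the squared
  drift from the snapshot; it is zero after the last step, so the potential then is the gap itself.
\<close>

definition drift_weight :: "nat \<Rightarrow> nat \<Rightarrow> nat \<Rightarrow> real" where
  "drift_weight b m t = real (m - t) * L / (4 * real b)"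

text \<open>
  Passing from \<open>norm (x - z)\<close> to \<open>norm (y - z)\<close> costs the factor \<open>1 + 1 / (2 m)\<close>, and the variance of the
  step costs \<open>L / (12 b)\<close>. In units of \<open>L / (4 b)\<close> one step releases \<open>1\<close>; of this \<open>1 / 3\<close> pays for the
  variance, at most \<open>1 / 2\<close> for the factor, and at most \<open>1 / 6\<close> for the contraction \<open>\<rho>\<close>.
\<close>

lemma drift_weight_decrease:
  assumes "t < m" and m: "(real m)\<^sup>2 \<le> real b" and mu: "real m * \<mu> \<le> L"
  shows "drift_weight b m (Suc t) * (1 + 1 / (2 * real m)) + L / (12 * real b)
    \<le> \<rho> * drift_weight b m t"
proof -
  define j where "j = real (m - Suc t)"
  have j: "0 \<le> j" "j + 1 \<le> real m" "real (m - t) = j + 1"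
    using assms(1) unfolding j_def by linarith+
  have m0: "real m > 0" using assms(1) by simp
  have "(real m)\<^sup>2 > 0" using m0 by simp
  with m have b0: "real b > 0" by linarith
  have rho: "1 - 1 / (6 * real m) \<le> \<rho>"
    using mu m0 L_pos unfolding \<rho>_def by (simp add: field_simps)
  have frac: "j / (2 * real m) \<le> 1 / 2" "(j + 1) / (6 * real m) \<le> 1 / 6"
    using j m0 by (simp_all add: field_simps)
  have "j * (1 + 1 / (2 * real m)) + 1 / 3 = j + j / (2 * real m) + 1 / 3"
    by (simp add: distrib_left)
  also have "\<dots> \<le> j + 1 - (j + 1) / (6 * real m)"
    using frac by linarith
  also have "\<dots> = (1 - 1 / (6 * real m)) * (j + 1)"
    by (simp add: left_diff_distrib)
  also have "\<dots> \<le> \<rho> * (j + 1)"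
    using rho j by (intro mult_right_mono) auto
  finally have "L / (4 * real b) * (j * (1 + 1 / (2 * real m)) + 1 / 3) \<le> L / (4 * real b) * (\<rho> * (j + 1))"
    using L_pos b0 by (intro mult_left_mono) auto
  moreover have "j * L / (4 * real b) * q + L / (12 * real b) = L / (4 * real b) * (j * q + 1 / 3)" for q
    by (simp add: distrib_left mult.left_commute)
  moreover have "\<rho> * ((j + 1) * L / (4 * real b)) = L / (4 * real b) * (\<rho> * (j + 1))"
    by simp
  ultimately show ?thesis
    unfolding drift_weight_def j(3) j_def[symmetric] by presburger
qed

text \<open>
  The square of the new step length enters the drift with the factor \<open>1 + 2 m\<close>. Since \<open>m\<^sup>2 \<le> b\<close>, it is
  dominated by the negative term of \<open>prox_gradient_step_gap\<close>.
\<close>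

lemma drift_weight_le:
  assumes "t < m" and m: "(real m)\<^sup>2 \<le> real b"
  shows "drift_weight b m (Suc t) * (1 + 2 * real m) \<le> 5 * L / 2"
proof -
  have m0: "real m \<ge> 1" using assms(1) by simp
  have "(real m)\<^sup>2 > 0" using m0 by simp
  with m have b0: "real b > 0" by linarith
  have "real (m - Suc t) * (1 + 2 * real m) \<le> real m * (3 * real m)"
    using m0 by (intro mult_mono) auto
  also have "\<dots> \<le> 3 * real b" using m by (simp add: power2_eq_square)
  finally have "L / (4 * real b) * (real (m - Suc t) * (1 + 2 * real m)) \<le> L / (4 * real b) * (3 * real b)"
    using L_pos b0 by (intro mult_left_mono) auto
  also have "\<dots> \<le> 5 * L / 2" using b0 L_pos by simp
  finally show ?thesis unfolding drift_weight_def by simp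
qed

text \<open>
  For each sample the weighted triangle inequality splits the new drift into the old drift and the
  square of the step; the latter is absorbed by the negative term of \<open>prox_gradient_step_gap\<close>. Taking
  expectations turns the error of the direction into drift again, plus the error of \<open>g\<close>.
\<close>

lemma potential_expected_decrease:
  fixes x z g :: 'a
  assumes b: "b > 0" and "t < m" and m: "(real m)\<^sup>2 \<le> real b" and mu: "real m * \<mu> \<le> L"
    and x: "h x \<noteq> \<infinity>"
  defines "next_point I \<equiv>
    prox \<eta> h (x - \<eta> *\<^sub>R (sample_mean (\<lambda>i. grad (f i) x - grad (f i) z) I + g))"
  shows "measure_pmf.expectation (sample_indices n b)
      (\<lambda>I. gap (next_point I) + drift_weight b m (Suc t) * (norm (next_point I - z))\<^sup>2)
    \<le> \<rho> * (gap x + drift_weight b m t * (norm (x - z))\<^sup>2) + (norm (g - grad F z))\<^sup>2 / (12 * L)"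
proof -
  define c where "c = drift_weight b m (Suc t)"
  define err where "err I = (norm (sample_mean (\<lambda>i. grad (f i) x - grad (f i) z) I + g - grad F x))\<^sup>2" for I
  have m0: "real m > 0" using assms(2) by simp
  have c: "0 \<le> c" "c * (1 + 2 * real m) \<le> 5 * L / 2"
    using L_pos drift_weight_le[OF assms(2) m] unfolding c_def by (auto simp: drift_weight_def)
  have fin: "finite (set_pmf (sample_indices n b))"
    by (rule finite_set_sample_indices[OF n_pos])
  have pointwise: "gap (next_point I) + c * (norm (next_point I - z))\<^sup>2
      \<le> \<rho> * gap x + c * (1 + 1 / (2 * real m)) * (norm (x - z))\<^sup>2 + err I / (12 * L)" for I
  proof -
    define y where "y = next_point I"
    have "(norm (y - z))\<^sup>2 \<le> (1 + 1 / (2 * real m)) * (norm (x - z))\<^sup>2 + (1 + 2 * real m) * (norm (y - x))\<^sup>2"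
      using norm_add_square_le_weighted[of "1 / (2 * real m)" "x - z" "y - x"] m0 by simp
    then have "c * (norm (y - z))\<^sup>2
        \<le> c * ((1 + 1 / (2 * real m)) * (norm (x - z))\<^sup>2 + (1 + 2 * real m) * (norm (y - x))\<^sup>2)"
      using c by (intro mult_left_mono)
    also have "\<dots> = c * (1 + 1 / (2 * real m)) * (norm (x - z))\<^sup>2
        + (c * (1 + 2 * real m)) * (norm (y - x))\<^sup>2"
      by (simp add: distrib_left[of c "_ * _" "_ * _"])
    also have "\<dots> \<le> c * (1 + 1 / (2 * real m)) * (norm (x - z))\<^sup>2 + 5 * L / 2 * (norm (y - x))\<^sup>2"
      using c by (intro add_left_mono mult_right_mono) auto
    finally have "c * (norm (y - z))\<^sup>2
        \<le> c * (1 + 1 / (2 * real m)) * (norm (x - z))\<^sup>2 + 5 * L / 2 * (norm (y - x))\<^sup>2" .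
    moreover have "gap y \<le> \<rho> * gap x - 5 * L / 2 * (norm (y - x))\<^sup>2 + err I / (12 * L)"
      unfolding err_def by (rule prox_gradient_step_gap[OF x]) (simp add: y_def next_point_def)
    ultimately show ?thesis unfolding y_def by linarith
  qed
  have "measure_pmf.expectation (sample_indices n b)
      (\<lambda>I. gap (next_point I) + c * (norm (next_point I - z))\<^sup>2)
    \<le> measure_pmf.expectation (sample_indices n b)
      (\<lambda>I. \<rho> * gap x + c * (1 + 1 / (2 * real m)) * (norm (x - z))\<^sup>2 + err I / (12 * L))"
    by (rule expectation_mono_finite[OF fin pointwise])
  also have "\<dots> = \<rho> * gap x + c * (1 + 1 / (2 * real m)) * (norm (x - z))\<^sup>2
      + measure_pmf.expectation (sample_indices n b) err / (12 * L)"
    by (simp add: integrable_measure_pmf_finite[OF fin])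
  also have "\<dots> \<le> \<rho> * gap x + c * (1 + 1 / (2 * real m)) * (norm (x - z))\<^sup>2
      + (L\<^sup>2 / real b * (norm (x - z))\<^sup>2 + (norm (g - grad F z))\<^sup>2) / (12 * L)"
    using minibatch_estimator_variance[OF b, of x z g] L_pos unfolding err_def
    by (intro add_left_mono divide_right_mono) auto
  also have "\<dots> = \<rho> * gap x + (c * (1 + 1 / (2 * real m)) + L / (12 * real b)) * (norm (x - z))\<^sup>2
      + (norm (g - grad F z))\<^sup>2 / (12 * L)"
    using L_pos by (simp add: distrib_right add_divide_distrib power2_eq_square)
  also have "\<dots> \<le> \<rho> * gap x + (\<rho> * drift_weight b m t) * (norm (x - z))\<^sup>2
      + (norm (g - grad F z))\<^sup>2 / (12 * L)"
    using drift_weight_decrease[OF assms(2) m mu] unfolding c_def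
    by (intro add_left_mono add_right_mono mult_right_mono) auto
  finally show ?thesis unfolding c_def by (simp add: distrib_left mult.assoc)
qed

text \<open>
  The error of \<open>g\<close> stays the same during an epoch, so the potential contracts towards a fixed level,
  the fixed point \<open>K\<close> of the one-step recursion \<open>a \<mapsto> \<rho> a + (norm (g - grad F z))\<^sup>2 / (12 L)\<close>.
\<close>

lemma inner_loop_expected_potential:
  assumes b: "b > 0" and m: "(real m)\<^sup>2 \<le> real b" and mu: "real m * \<mu> \<le> L"
    and z: "h z \<noteq> \<infinity>"
  shows "t \<le> m \<Longrightarrow> measure_pmf.expectation (svrg_inner n f h \<eta> b z g t)
      (\<lambda>x. gap x + drift_weight b m t * (norm (x - z))\<^sup>2)
    \<le> \<rho> ^ t * gap z + (1 - \<rho> ^ t) * ((norm (g - grad F z))\<^sup>2 / (2 * \<mu>))"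
proof (induction t)
  case (Suc t)
  define K where "K = (norm (g - grad F z))\<^sup>2 / (2 * \<mu>)"
  define pot where "pot t x = gap x + drift_weight b m t * (norm (x - z))\<^sup>2" for t x
  let ?p = "svrg_inner n f h \<eta> b z g t"
  have fin: "finite (set_pmf ?p)" by (rule finite_svrg_inner)
  have K: "(norm (g - grad F z))\<^sup>2 / (12 * L) = (1 - \<rho>) * K"
    using mu_pos L_pos unfolding \<rho>_def K_def by (simp add: field_simps)
  have IH: "measure_pmf.expectation ?p (pot t) \<le> \<rho> ^ t * gap z + (1 - \<rho> ^ t) * K"
    using Suc unfolding pot_def[abs_def] K_def by simp
  have "measure_pmf.expectation (svrg_inner n f h \<eta> b z g (Suc t)) (pot (Suc t))
    = measure_pmf.expectation ?p (\<lambda>x. measure_pmf.expectation (sample_indices n b)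
        (\<lambda>I. pot (Suc t) (prox \<eta> h (x - \<eta> *\<^sub>R
          (sample_mean (\<lambda>i. grad (f i) x - grad (f i) z) I + g)))))"
    using fin finite_set_sample_indices[OF n_pos, of b]
    by (simp add: expectation_bind_pmf_finite Let_def)
  also have "\<dots> \<le> measure_pmf.expectation ?p (\<lambda>x. \<rho> * pot t x + (1 - \<rho>) * K)"
  proof (rule expectation_mono_finite[OF fin])
    fix x assume "x \<in> set_pmf ?p"
    then have "h x \<noteq> \<infinity>" by (rule svrg_inner_feasible[OF z])
    then show "measure_pmf.expectation (sample_indices n b)
        (\<lambda>I. pot (Suc t) (prox \<eta> h (x - \<eta> *\<^sub>R
          (sample_mean (\<lambda>i. grad (f i) x - grad (f i) z) I + g)))) \<le> \<rho> * pot t x + (1 - \<rho>) * K"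
      using Suc.prems unfolding pot_def K[symmetric]
      by (intro potential_expected_decrease[OF b _ m mu]) auto
  qed
  also have "\<dots> = \<rho> * measure_pmf.expectation ?p (pot t) + (1 - \<rho>) * K"
    by (simp add: integrable_measure_pmf_finite[OF fin])
  also have "\<dots> \<le> \<rho> * (\<rho> ^ t * gap z + (1 - \<rho> ^ t) * K) + (1 - \<rho>) * K"
    using IH rho_bounds by (intro add_right_mono mult_left_mono) auto
  also have "\<dots> = \<rho> ^ Suc t * gap z + (1 - \<rho> ^ Suc t) * K"
    by (simp add: algebra_simps)
  finally show ?case unfolding pot_def[abs_def] K_def .
qed simp

lemma inner_loop_expected_gap:
  assumes b: "b > 0" and m: "(real m)\<^sup>2 \<le> real b" and mu: "real m * \<mu> \<le> L"
    and z: "h z \<noteq> \<infinity>"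
  shows "measure_pmf.expectation (svrg_inner n f h \<eta> b z g m) gap
    \<le> \<rho> ^ m * gap z + (1 - \<rho> ^ m) * ((norm (g - grad F z))\<^sup>2 / (2 * \<mu>))"
  using inner_loop_expected_potential[OF b m mu z, of m g] by (simp add: drift_weight_def)

section \<open>Contraction over the epochs\<close>

lemma finite_batch_grad: "finite (set_pmf (batch_grad n f B z))"
  using finite_set_sample_indices[OF n_pos] by (simp add: batch_grad_def)

lemma batch_grad_full_error:
  "measure_pmf.expectation (batch_grad n f n z) (\<lambda>g. (norm (g - grad F z))\<^sup>2) = 0"
  by (simp add: batch_grad_def)

lemma batch_grad_sampled_error:
  assumes "B > 0" "B \<noteq> n" "variance_bound n f \<sigma>"
  shows "measure_pmf.expectation (batch_grad n f B z) (\<lambda>g. (norm (g - grad F z))\<^sup>2) \<le> \<sigma>\<^sup>2 / real B"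
proof -
  have c: "grad F z = (1 / real n) *\<^sub>R (\<Sum>i=1..n. grad (f i) z)"
    by (rule grad_favg) (rule diff)
  have "measure_pmf.expectation (batch_grad n f B z) (\<lambda>g. (norm (g - grad F z))\<^sup>2)
    = measure_pmf.expectation (pmf_of_set {1..n}) (\<lambda>i. (norm (grad (f i) z - grad F z))\<^sup>2) / real B"
    using expectation_sample_mean_norm2[OF n_pos assms(1) c, of 0] assms(2)
    by (simp add: batch_grad_def)
  also have "\<dots> \<le> \<sigma>\<^sup>2 / real B"
    using assms(3) unfolding variance_bound_def by (intro divide_right_mono) auto
  finally show ?thesis .
qed

lemma finite_prox_svrg_plus: "finite (set_pmf (prox_svrg_plus n f h x0 B b m \<eta> S))"
  by (induction S) (auto simp: finite_svrg_inner finite_batch_grad)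

lemma prox_svrg_plus_feasible:
  assumes "h x0 \<noteq> \<infinity>"
  shows "x \<in> set_pmf (prox_svrg_plus n f h x0 B b m \<eta> S) \<Longrightarrow> h x \<noteq> \<infinity>"
  using assms by (induction S arbitrary: x) (auto dest: svrg_inner_feasible)

text \<open>
  The level towards which the gap contracts within an epoch is linear in the squared error of the
  snapshot gradient, hence only the expectation of that error matters over several epochs.
\<close>

lemma prox_svrg_plus_expected_gap:
  assumes b: "b > 0" and m: "(real m)\<^sup>2 \<le> real b" and mu: "real m * \<mu> \<le> L"
    and x0: "h x0 \<noteq> \<infinity>"
    and batch: "\<And>z. measure_pmf.expectation (batch_grad n f B z) (\<lambda>g. (norm (g - grad F z))\<^sup>2) \<le> e"
  shows "measure_pmf.expectation (prox_svrg_plus n f h x0 B b m \<eta> S) gap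
    \<le> \<rho> ^ (S * m) * gap x0 + (1 - \<rho> ^ (S * m)) * (e / (2 * \<mu>))"
proof (induction S)
  case (Suc S)
  define K where "K = e / (2 * \<mu>)"
  let ?p = "prox_svrg_plus n f h x0 B b m \<eta> S"
  have fin: "finite (set_pmf ?p)" by (rule finite_prox_svrg_plus)
  have pow: "0 \<le> \<rho> ^ m" "\<rho> ^ m \<le> 1"
    using rho_bounds by (auto intro: power_le_one)
  have epoch: "measure_pmf.expectation (batch_grad n f B z)
      (\<lambda>g. measure_pmf.expectation (svrg_inner n f h \<eta> b z g m) gap) \<le> \<rho> ^ m * gap z + (1 - \<rho> ^ m) * K"
    if z: "h z \<noteq> \<infinity>" for z
  proof -
    define D where "D g = (norm (g - grad F z))\<^sup>2" for g
    have "measure_pmf.expectation (batch_grad n f B z)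
        (\<lambda>g. measure_pmf.expectation (svrg_inner n f h \<eta> b z g m) gap)
      \<le> measure_pmf.expectation (batch_grad n f B z)
        (\<lambda>g. \<rho> ^ m * gap z + (1 - \<rho> ^ m) * (D g / (2 * \<mu>)))"
      unfolding D_def
      by (intro expectation_mono_finite finite_batch_grad inner_loop_expected_gap[OF b m mu z])
    also have "\<dots> = \<rho> ^ m * gap z
        + (1 - \<rho> ^ m) * (measure_pmf.expectation (batch_grad n f B z) D / (2 * \<mu>))"
      by (simp add: integrable_measure_pmf_finite[OF finite_batch_grad])
    also have "\<dots> \<le> \<rho> ^ m * gap z + (1 - \<rho> ^ m) * K"
      using batch[of z] pow mu_pos unfolding D_def[abs_def] K_def
      by (intro add_left_mono mult_left_mono divide_right_mono) auto
    finally show ?thesis .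
  qed
  have "measure_pmf.expectation (prox_svrg_plus n f h x0 B b m \<eta> (Suc S)) gap
    = measure_pmf.expectation ?p (\<lambda>z. measure_pmf.expectation (batch_grad n f B z)
        (\<lambda>g. measure_pmf.expectation (svrg_inner n f h \<eta> b z g m) gap))"
    using fin finite_batch_grad finite_svrg_inner by (simp add: expectation_bind_pmf_finite)
  also have "\<dots> \<le> measure_pmf.expectation ?p (\<lambda>z. \<rho> ^ m * gap z + (1 - \<rho> ^ m) * K)"
    by (intro expectation_mono_finite fin epoch) (rule prox_svrg_plus_feasible[OF x0])
  also have "\<dots> = \<rho> ^ m * measure_pmf.expectation ?p gap + (1 - \<rho> ^ m) * K"
    by (simp add: integrable_measure_pmf_finite[OF fin])
  also have "\<dots> \<le> \<rho> ^ m * (\<rho> ^ (S * m) * gap x0 + (1 - \<rho> ^ (S * m)) * K) + (1 - \<rho> ^ m) * K"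
    using Suc.IH pow unfolding K_def by (intro add_right_mono mult_left_mono) auto
  also have "\<dots> = \<rho> ^ (Suc S * m) * gap x0 + (1 - \<rho> ^ (Suc S * m)) * K"
    by (simp add: power_add algebra_simps)
  finally show ?case unfolding K_def .
qed simp

lemma expected_gap_eq:
  assumes "finite (set_pmf p)" and "\<And>x. x \<in> set_pmf p \<Longrightarrow> h x \<noteq> \<infinity>"
  shows "expected_gap n f h p = ennreal (measure_pmf.expectation p gap)"
proof -
  have "expected_gap n f h p = (\<integral>\<^sup>+ x. ennreal (gap x) \<partial>measure_pmf p)"
    unfolding expected_gap_def using assms(2)
    by (intro nn_integral_cong_AE) (simp add: AE_measure_pmf_iff Phi_minus_opt)
  also have "\<dots> = ennreal (measure_pmf.expectation p gap)"
    using assms gap_nonneg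
    by (intro nn_integral_eq_integral integrable_measure_pmf_finite) (auto simp: AE_measure_pmf_iff)
  finally show ?thesis .
qed

lemma prox_svrg_plus_gap_le:
  assumes b: "b > 0" and m: "(real m)\<^sup>2 \<le> real b" and mu: "real m * \<mu> \<le> L"
    and x0: "h x0 \<noteq> \<infinity>"
    and batch: "\<And>z. measure_pmf.expectation (batch_grad n f B z) (\<lambda>g. (norm (g - grad F z))\<^sup>2) \<le> e"
    and e: "0 \<le> e" "e \<le> \<mu> * \<epsilon>"
    and S: "\<rho> ^ (S * m) * gap x0 \<le> \<epsilon> / 2"
  shows "expected_gap n f h (prox_svrg_plus n f h x0 B b m \<eta> S) \<le> ennreal \<epsilon>"
proof -
  have "(1 - \<rho> ^ (S * m)) * (e / (2 * \<mu>)) \<le> 1 * (e / (2 * \<mu>))"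
    using rho_bounds e mu_pos by (intro mult_right_mono) auto
  also have "\<dots> \<le> \<epsilon> / 2"
    using e mu_pos by (simp add: field_simps)
  finally have "measure_pmf.expectation (prox_svrg_plus n f h x0 B b m \<eta> S) gap \<le> \<epsilon>"
    using prox_svrg_plus_expected_gap[OF b m mu x0 batch, of S] S by linarith
  then show ?thesis
    using expected_gap_eq[OF finite_prox_svrg_plus prox_svrg_plus_feasible[OF x0]]
    by (simp add: ennreal_leI)
qed

end

section \<open>Counting epochs and oracle calls\<close>

text \<open>
  Since \<open>1 - q \<le> exp (- q)\<close>, a total of \<open>(6 L / \<mu>) ln (2 (1 + D) / \<epsilon>)\<close> inner steps suffices. Using \<open>1 + D\<close>
  for \<open>D\<close> inside the logarithm keeps the argument positive when the initial point is optimal. For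
  \<open>\<epsilon> \<le> 1 / 2\<close> the bound \<open>ln (1 / \<epsilon>) \<ge> ln 2 \<ge> 1 / 2\<close> absorbs all additive terms, including the
  rounding up to full epochs, as an epoch has at most \<open>L / \<mu>\<close> steps.
\<close>

lemma sufficient_epochs:
  fixes L \<mu> D \<epsilon> :: real and m :: nat
  assumes L: "L > 0" and mu: "\<mu> > 0" "\<mu> \<le> L" and D: "D \<ge> 0" and eps: "\<epsilon> > 0"
    and m: "m > 0" "real m * \<mu> \<le> L"
  obtains S where "S > 0" "(1 - \<mu> / (6 * L)) ^ (S * m) * D \<le> \<epsilon> / 2"
    "\<epsilon> \<le> 1 / 2 \<Longrightarrow> real (S * m) \<le> 16 * (L / \<mu>) * (1 + D) * ln (1 / \<epsilon>)"
proof -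
  define X where "X = max 0 (ln (2 * (1 + D) / \<epsilon>))"
  define T where "T = 6 * L * X / \<mu>"
  define S where "S = nat \<lceil>T / real m\<rceil> + 1"
  have T0: "T \<ge> 0" using L mu unfolding T_def X_def by simp
  have "T / real m \<le> real S" unfolding S_def by linarith
  then have T_le: "T \<le> real (S * m)" using m by (simp add: field_simps)
  have decay: "(1 - \<mu> / (6 * L)) ^ (S * m) * D \<le> \<epsilon> / 2"
  proof -
    have "(1 - \<mu> / (6 * L)) ^ (S * m) \<le> exp (- \<mu> / (6 * L)) ^ (S * m)"
      using exp_ge_add_one_self[of "- \<mu> / (6 * L)"] L mu by (intro power_mono) (auto simp: field_simps)
    also have "\<dots> = exp (- (\<mu> / (6 * L) * real (S * m)))"
      by (simp flip: exp_of_nat_mult add: mult.commute)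
    also have "\<dots> \<le> exp (- X)"
    proof -
      have "X = \<mu> / (6 * L) * T" using L mu unfolding T_def by simp
      also have "\<dots> \<le> \<mu> / (6 * L) * real (S * m)"
        using T_le L mu by (intro mult_left_mono) auto
      finally show ?thesis by simp
    qed
    also have "\<dots> \<le> exp (- ln (2 * (1 + D) / \<epsilon>))"
      unfolding X_def by simp
    also have "\<dots> = \<epsilon> / (2 * (1 + D))"
      using D eps by (simp add: exp_minus)
    finally have "(1 - \<mu> / (6 * L)) ^ (S * m) * D \<le> \<epsilon> / (2 * (1 + D)) * D"
      using D by (intro mult_right_mono)
    also have "\<dots> \<le> \<epsilon> / 2"
      using D eps by (simp add: field_simps)
    finally show ?thesis .
  qed
  have count: "real (S * m) \<le> 16 * (L / \<mu>) * (1 + D) * ln (1 / \<epsilon>)" if small: "\<epsilon> \<le> 1 / 2"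
  proof -
    define l where "l = ln (1 / \<epsilon>)"
    have "ln 2 \<le> l"
      using small eps unfolding l_def by (subst ln_le_cancel_iff) (auto simp: field_simps)
    then have l: "ln 2 \<le> l" "1 / 2 \<le> l" using ln2_ge_two_thirds by auto
    have "ln (2 * (1 + D) / \<epsilon>) = ln (2 * (1 + D)) - ln \<epsilon>"
      using D eps by (subst ln_div) auto
    also have "ln (2 * (1 + D)) = ln 2 + ln (1 + D)"
      using D by (subst ln_mult) auto
    also have "ln 2 + ln (1 + D) - ln \<epsilon> = ln 2 + ln (1 + D) + l"
      using eps unfolding l_def by (simp add: ln_div)
    also have "\<dots> \<le> l + D + l"
      using l ln_add_one_self_le_self[OF D] by linarith
    also have "\<dots> \<le> 2 * (1 + D) * l"
      using mult_left_mono[OF l(2) D] by (simp add: algebra_simps)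
    finally have X: "X \<le> 2 * (1 + D) * l"
      using l D unfolding X_def by simp
    have "0 \<le> T / real m" using T0 by simp
    then have "real S \<le> T / real m + 2"
      unfolding S_def by linarith
    then have "real (S * m) \<le> T + 2 * real m"
      using m(1) by (simp add: field_simps)
    also have "\<dots> \<le> T + 2 * (L / \<mu>)"
      using m mu by (simp add: field_simps)
    also have "\<dots> = L / \<mu> * (6 * X + 2)"
      unfolding T_def by (simp add: algebra_simps)
    also have "\<dots> \<le> L / \<mu> * (16 * ((1 + D) * l))"
    proof (rule mult_left_mono)
      have "l \<le> (1 + D) * l" using l D by (simp add: distrib_right)
      then show "6 * X + 2 \<le> 16 * ((1 + D) * l)" using X l by linarith
    qed (use L mu in auto)
    finally show ?thesis unfolding l_def by (simp only: mult_ac)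
  qed
  show thesis
    by (rule that[OF _ decay count]) (simp_all add: S_def)
qed

lemma sfo_calls_le:
  fixes L \<mu> D l :: real
  assumes T: "real (S * m) \<le> 16 * (L / \<mu>) * (1 + D) * l"
    and m: "m > 0" "sqrt (real b) \<le> 2 * real m" and b: "b > 0"
  shows "real (sfo_calls S m B b)
    \<le> 32 * L * (1 + D) * (real B * (1 / (\<mu> * sqrt (real b))) * l + real b / \<mu> * l)"
proof -
  \<comment> \<open>An epoch costs its batch once, so each inner step carries the share \<open>B / m\<close>, and \<open>m\<close> is \<open>sqrt b\<close> up to a factor \<open>2\<close>.\<close>
  have "1 / real m \<le> 2 / sqrt (real b)"
    using m b by (simp add: field_simps)
  then have "real (S * m) * real B * (1 / real m) \<le> real (S * m) * real B * (2 / sqrt (real b))"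
    by (intro mult_left_mono) auto
  then have "real S * real B \<le> real (S * m) * (2 * real B / sqrt (real b))"
    using m by (simp add: mult_ac)
  also have "\<dots> \<le> 16 * (L / \<mu>) * (1 + D) * l * (2 * real B / sqrt (real b))"
    using T by (intro mult_right_mono) auto
  finally have batch: "real S * real B \<le> 32 * L * (1 + D) * (real B * (1 / (\<mu> * sqrt (real b))) * l)"
    by (simp add: mult_ac)
  have "real (S * m) * real b \<le> 16 * (L / \<mu>) * (1 + D) * l * real b"
    using T by (intro mult_right_mono) auto
  moreover have "0 \<le> real (S * m) * real b" by simp
  ultimately have "real (S * m) * real b \<le> 2 * (16 * (L / \<mu>) * (1 + D) * l * real b)"
    by linarith
  then have "real (S * m) * real b \<le> 32 * L * (1 + D) * (real b / \<mu> * l)"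
    by (simp add: mult_ac)
  moreover have "real (sfo_calls S m B b) = real S * real B + real (S * m) * real b"
    unfolding sfo_calls_def by (simp add: distrib_left)
  ultimately show ?thesis using batch by (simp only: distrib_left)
qed

text \<open>
  The \<open>1\<close> lost in rounding up is at most \<open>L / (\<mu> \<epsilon>)\<close>.
\<close>

lemma rounded_batch_size_le:
  fixes L \<mu> \<sigma> \<epsilon> :: real
  assumes "L > 0" "\<mu> > 0" "\<mu> \<le> L" "0 < \<epsilon>" "\<epsilon> \<le> 1"
  shows "real (min (nat \<lceil>6 * \<sigma>\<^sup>2 / (\<mu> * \<epsilon>)\<rceil>) n)
    \<le> (1 + L + 6 * \<sigma>\<^sup>2) * min (real n) (1 / (\<mu> * \<epsilon>))"
proof -
  define B where "B = min (nat \<lceil>6 * \<sigma>\<^sup>2 / (\<mu> * \<epsilon>)\<rceil>) n"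
  have "1 \<le> 1 + L + 6 * \<sigma>\<^sup>2" using assms by simp
  then have "1 * real n \<le> (1 + L + 6 * \<sigma>\<^sup>2) * real n" by (intro mult_right_mono) auto
  moreover have "real B \<le> real n" unfolding B_def by simp
  ultimately have n: "real B \<le> (1 + L + 6 * \<sigma>\<^sup>2) * real n" by linarith
  have pos: "\<mu> * \<epsilon> > 0" using assms by simp
  have "\<mu> * \<epsilon> \<le> \<mu> * 1" using assms by (intro mult_left_mono) auto
  with assms have "\<mu> * \<epsilon> \<le> L" by linarith
  then have one: "1 \<le> L / (\<mu> * \<epsilon>)" using pos by simp
  have "6 * \<sigma>\<^sup>2 / (\<mu> * \<epsilon>) \<ge> 0" using pos by simp
  then have "real (nat \<lceil>6 * \<sigma>\<^sup>2 / (\<mu> * \<epsilon>)\<rceil>) \<le> 6 * \<sigma>\<^sup>2 / (\<mu> * \<epsilon>) + 1"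
    by linarith
  then have "real B \<le> 6 * \<sigma>\<^sup>2 / (\<mu> * \<epsilon>) + L / (\<mu> * \<epsilon>)"
    using one unfolding B_def by linarith
  also have "\<dots> = (L + 6 * \<sigma>\<^sup>2) * (1 / (\<mu> * \<epsilon>))"
    by (simp add: add_divide_distrib)
  also have "\<dots> \<le> (1 + L + 6 * \<sigma>\<^sup>2) * (1 / (\<mu> * \<epsilon>))"
    using pos by (intro mult_right_mono) auto
  finally show ?thesis using n unfolding B_def[symmetric] by (simp add: min_def)
qed

section \<open>Oracle complexity\<close>

theorem theorem2:
  fixes f :: "nat \<Rightarrow> 'a::euclidean_space \<Rightarrow> real"
    and h :: "'a \<Rightarrow> ereal"
    and x0 :: 'a
    and n b m :: nat
    and L \<mu> \<eta> \<epsilon> D :: real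
  assumes "L > 0"
    and "\<And>i x. i \<in> {1..n} \<Longrightarrow> f i differentiable (at x)"
    and "\<And>i. i \<in> {1..n} \<Longrightarrow> L-lipschitz_on UNIV (grad (f i))"
    and "proper_fun h"
    and "convex_fun h"
    and "prox_well_defined \<eta> h"
    and "Phi n f h x0 < \<infinity>"
    and "D = real_of_ereal (Phi n f h x0 - Phi_opt n f h)"
    and "\<epsilon> > 0"
    and "\<eta> = 1 / (6 * L)"
    and "1 \<le> b" and "b \<le> n"
    and "m = nat \<lfloor>sqrt (real b)\<rfloor>"
    and "\<mu> > 0"
    and "PL_condition n f h \<eta> \<mu>"
    and "L / \<mu> > sqrt (real n)"
  shows
    "(\<forall>B. B = n \<longrightarrow>
       (\<exists>S>0. expected_gap n f h (prox_svrg_plus n f h x0 B b m \<eta> S) \<le> ennreal \<epsilon> \<and>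
          po_calls S m = S * m \<and>
          (\<epsilon> \<le> 1 / 2 \<longrightarrow>
             real (sfo_calls S m B b) \<le> O_const L D *
               (real n / (\<mu> * sqrt (real b)) * ln (1 / \<epsilon>) + real b / \<mu> * ln (1 / \<epsilon>)) \<and>
             real (S * m) \<le> O_const L D * (1 / \<mu> * ln (1 / \<epsilon>))))) \<and>
     (\<forall>\<sigma> B. \<sigma> > 0 \<and> variance_bound n f \<sigma> \<and>
         B = min (nat \<lceil>6 * \<sigma>\<^sup>2 / (\<mu> * \<epsilon>)\<rceil>) n \<longrightarrow>
       (\<exists>S>0. expected_gap n f h (prox_svrg_plus n f h x0 B b m \<eta> S) \<le> ennreal \<epsilon> \<and>
          po_calls S m = S * m \<and>
          (\<epsilon> \<le> 1 / 2 \<longrightarrow>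
             real (sfo_calls S m B b) \<le> O_const_sigma L D \<sigma> *
               (min (real n) (1 / (\<mu> * \<epsilon>)) * (1 / (\<mu> * sqrt (real b))) * ln (1 / \<epsilon>)
                + real b / \<mu> * ln (1 / \<epsilon>)) \<and>
             real (S * m) \<le> O_const L D * (1 / \<mu> * ln (1 / \<epsilon>)))))"
proof -
  have n_pos: "n > 0" using assms(11,12) by simp
  have "1 \<le> sqrt (real n)" using n_pos by simp
  then have "1 \<le> L / \<mu>" using assms(16) by linarith
  then have mu_le: "\<mu> \<le> L" using assms(14) by simp
  interpret prox_PL_problem f h n L \<mu> \<eta>
    using n_pos mu_le assms(1-6,10,14,15) by unfold_locales
  have x0: "h x0 \<noteq> \<infinity>"
    using assms(7) unfolding Phi_def by auto
  have D: "D = gap x0" unfolding assms(8) Phi_minus_opt[OF x0] by simp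
  have D_nonneg: "D \<ge> 0" unfolding D by (rule gap_nonneg[OF x0])
  have b_pos: "b > 0" using assms(11) by simp
  have sqrt_b: "1 \<le> sqrt (real b)" using assms(11) by simp
  \<comment> \<open>Rounding a number that is at least \<open>1\<close> down to an integer at most halves it.\<close>
  have "1 \<le> \<lfloor>sqrt (real b)\<rfloor>" using sqrt_b by simp
  then have m_floor: "real m = of_int \<lfloor>sqrt (real b)\<rfloor>" "1 \<le> real m"
    unfolding assms(13) by simp_all
  then have m_pos: "m > 0" and m_le: "real m \<le> sqrt (real b)"
    and m_ge: "sqrt (real b) \<le> 2 * real m"
    by linarith+
  have "(real m)\<^sup>2 \<le> (sqrt (real b))\<^sup>2" using m_le by (intro power_mono) auto
  then have m_sq: "(real m)\<^sup>2 \<le> real b" by simp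
  have "sqrt (real b) \<le> sqrt (real n)" using assms(12) by simp
  then have "real m \<le> L / \<mu>" using m_le assms(16) by linarith
  then have m_mu: "real m * \<mu> \<le> L" using assms(14) by (simp add: field_simps)
  \<comment> \<open>The same number of epochs serves both batch sizes: half of \<open>\<epsilon>\<close> is left for the sampling error.\<close>
  obtain S where S: "S > 0" "\<rho> ^ (S * m) * gap x0 \<le> \<epsilon> / 2"
    and S_le: "\<epsilon> \<le> 1 / 2 \<Longrightarrow> real (S * m) \<le> 16 * (L / \<mu>) * (1 + D) * ln (1 / \<epsilon>)"
    using sufficient_epochs[OF assms(1,14) mu_le D_nonneg assms(9) m_pos m_mu]
    unfolding D \<rho>_def by metis
  have gap_le: "expected_gap n f h (prox_svrg_plus n f h x0 B b m \<eta> S) \<le> ennreal \<epsilon>"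
    if "\<And>z. measure_pmf.expectation (batch_grad n f B z) (\<lambda>g. (norm (g - grad F z))\<^sup>2) \<le> e"
      "0 \<le> e" "e \<le> \<mu> * \<epsilon>" for B e
    by (rule prox_svrg_plus_gap_le[OF b_pos m_sq m_mu x0 that S(2)])
  have full: "expected_gap n f h (prox_svrg_plus n f h x0 n b m \<eta> S) \<le> ennreal \<epsilon>"
    by (rule gap_le[of n 0]) (use assms(9,14) in \<open>simp_all add: batch_grad_full_error\<close>)
  have po: "po_calls S m = S * m" by (simp add: po_calls_def)
  have ln_nonneg: "0 \<le> ln (1 / \<epsilon>)" if "\<epsilon> \<le> 1 / 2" using that assms(9) by simp
  have po_le: "real (S * m) \<le> O_const L D * (1 / \<mu> * ln (1 / \<epsilon>))" if "\<epsilon> \<le> 1 / 2"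
  proof -
    define E where "E = L * (1 + D) * (1 / \<mu> * ln (1 / \<epsilon>))"
    have "0 \<le> E"
      using ln_nonneg[OF that] assms(1,14) D_nonneg unfolding E_def by simp
    moreover have "16 * (L / \<mu>) * (1 + D) * ln (1 / \<epsilon>) = 16 * E"
      unfolding E_def by simp
    ultimately have "real (S * m) \<le> 100 * E"
      using S_le[OF that] by linarith
    then show ?thesis unfolding O_const_def E_def by (simp only: mult.assoc)
  qed
  have sfo_le: "real (sfo_calls S m B b) \<le> O_const L D *
      (real B * (1 / (\<mu> * sqrt (real b))) * ln (1 / \<epsilon>) + real b / \<mu> * ln (1 / \<epsilon>))"
    if "\<epsilon> \<le> 1 / 2" for B
  proof -
    let ?c = "real B * (1 / (\<mu> * sqrt (real b))) * ln (1 / \<epsilon>) + real b / \<mu> * ln (1 / \<epsilon>)"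
    have "real (sfo_calls S m B b) \<le> 32 * L * (1 + D) * ?c"
      by (rule sfo_calls_le[OF S_le[OF that] m_pos m_ge b_pos])
    also have "\<dots> \<le> 100 * L * (1 + D) * ?c"
      using ln_nonneg[OF that] assms(1,14) D_nonneg
      by (intro mult_right_mono add_nonneg_nonneg mult_nonneg_nonneg) auto
    finally show ?thesis unfolding O_const_def .
  qed
  have sampled: "expected_gap n f h (prox_svrg_plus n f h x0 B b m \<eta> S) \<le> ennreal \<epsilon>"
    if "\<sigma> > 0" "variance_bound n f \<sigma>" and B: "B = min (nat \<lceil>6 * \<sigma>\<^sup>2 / (\<mu> * \<epsilon>)\<rceil>) n" for \<sigma> B
  proof (cases "B = n")
    case True
    then show ?thesis using full by simp
  next
    case False
    have y: "6 * \<sigma>\<^sup>2 / (\<mu> * \<epsilon>) > 0" using that(1) assms(9,14) by simp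
    have B_ge: "6 * \<sigma>\<^sup>2 / (\<mu> * \<epsilon>) \<le> real B" using False unfolding B by linarith
    with y have B_pos: "real B > 0" by linarith
    show ?thesis
    proof (rule gap_le[of B "\<sigma>\<^sup>2 / real B"])
      show "measure_pmf.expectation (batch_grad n f B z) (\<lambda>g. (norm (g - grad F z))\<^sup>2) \<le> \<sigma>\<^sup>2 / real B" for z
        using B_pos False that(2) by (intro batch_grad_sampled_error) auto
      \<comment> \<open>This is what the batch size is chosen for: the sampling error \<open>\<sigma>\<^sup>2 / B\<close> is at most a multiple of \<open>\<mu> \<epsilon>\<close>.\<close>
      have "6 * \<sigma>\<^sup>2 \<le> \<mu> * \<epsilon> * real B" using B_ge assms(9,14) by (simp add: field_simps)
      then have "\<sigma>\<^sup>2 \<le> \<mu> * \<epsilon> * real B" using zero_le_power2[of \<sigma>] by linarith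
      then show "\<sigma>\<^sup>2 / real B \<le> \<mu> * \<epsilon>" using B_pos by (simp add: divide_le_eq)
    qed simp
  qed
  have sampled_sfo: "real (sfo_calls S m B b) \<le> O_const_sigma L D \<sigma> *
      (min (real n) (1 / (\<mu> * \<epsilon>)) * (1 / (\<mu> * sqrt (real b))) * ln (1 / \<epsilon>)
       + real b / \<mu> * ln (1 / \<epsilon>))"
    if small: "\<epsilon> \<le> 1 / 2" and B: "B = min (nat \<lceil>6 * \<sigma>\<^sup>2 / (\<mu> * \<epsilon>)\<rceil>) n" for \<sigma> B
  proof -
    define C where "C = 1 + L + 6 * \<sigma>\<^sup>2"
    define u where "u = 1 / (\<mu> * sqrt (real b)) * ln (1 / \<epsilon>)"
    define w where "w = real b / \<mu> * ln (1 / \<epsilon>)"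
    have C: "1 \<le> C" using assms(1) unfolding C_def by simp
    have uw: "0 \<le> u" "0 \<le> w" using ln_nonneg[OF small] assms(14) unfolding u_def w_def by auto
    have "real B \<le> C * min (real n) (1 / (\<mu> * \<epsilon>))"
      unfolding B C_def by (rule rounded_batch_size_le) (use assms(1,9,14) mu_le small in auto)
    then have "real B * u \<le> C * min (real n) (1 / (\<mu> * \<epsilon>)) * u"
      using uw by (intro mult_right_mono)
    moreover have "w \<le> C * w" using C uw by (simp add: mult_le_cancel_right1)
    ultimately have "real B * u + w \<le> C * (min (real n) (1 / (\<mu> * \<epsilon>)) * u + w)"
      by (simp add: distrib_left mult.assoc)
    then have "O_const L D * (real B * u + w)
        \<le> O_const L D * (C * (min (real n) (1 / (\<mu> * \<epsilon>)) * u + w))"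
      using assms(1) D_nonneg unfolding O_const_def by (intro mult_left_mono) auto
    also have "\<dots> = O_const_sigma L D \<sigma> * (min (real n) (1 / (\<mu> * \<epsilon>)) * u + w)"
      unfolding O_const_def O_const_sigma_def C_def by (simp only: mult.assoc)
    finally show ?thesis
      using sfo_le[OF small, of B] unfolding u_def w_def by (simp only: mult.assoc)
  qed
  show ?thesis
  proof (intro conjI allI impI; (elim conjE)?)
    fix B assume "B = n"
    then show "\<exists>S>0. expected_gap n f h (prox_svrg_plus n f h x0 B b m \<eta> S) \<le> ennreal \<epsilon> \<and>
          po_calls S m = S * m \<and>
          (\<epsilon> \<le> 1 / 2 \<longrightarrow>
             real (sfo_calls S m B b) \<le> O_const L D *
               (real n / (\<mu> * sqrt (real b)) * ln (1 / \<epsilon>) + real b / \<mu> * ln (1 / \<epsilon>)) \<and>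
             real (S * m) \<le> O_const L D * (1 / \<mu> * ln (1 / \<epsilon>)))"
      using S(1) full po po_le sfo_le[of n] by (intro exI[of _ S]) simp
  next
    fix \<sigma> B
    assume "\<sigma> > 0" "variance_bound n f \<sigma>" "B = min (nat \<lceil>6 * \<sigma>\<^sup>2 / (\<mu> * \<epsilon>)\<rceil>) n"
    then show "\<exists>S>0. expected_gap n f h (prox_svrg_plus n f h x0 B b m \<eta> S) \<le> ennreal \<epsilon> \<and>
          po_calls S m = S * m \<and>
          (\<epsilon> \<le> 1 / 2 \<longrightarrow>
             real (sfo_calls S m B b) \<le> O_const_sigma L D \<sigma> *
               (min (real n) (1 / (\<mu> * \<epsilon>)) * (1 / (\<mu> * sqrt (real b))) * ln (1 / \<epsilon>)
                + real b / \<mu> * ln (1 / \<epsilon>)) \<and>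
             real (S * m) \<le> O_const L D * (1 / \<mu> * ln (1 / \<epsilon>)))"
      using S(1) sampled po po_le sampled_sfo by blast
  qed
qed

end
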